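(* Let $X_1,\dots,X_n\in\mathbb{R}$ be observations with empirical distribution function $\mathbb{F}_n$, and suppose $\mathbb{F}_n$ is non-degenerate (i.e. the $X_i$ are not all equal). Then the maximum likelihood estimator $(\hat\theta_n,\hat\psi_n)$ exists, that is, there is $(\hat\theta_n,\hat\psi_n)\in\mathbb{R}\times\mathcal{SC}_0$ with $$\Psi_n(\hat\theta_n,\hat\psi_n)=\sup_{\theta\in\mathbb{R},\,\psi\in\mathcal{SC}_0}\Psi_n(\theta,\psi).$$ Moreover, $\hat\theta_n\in[X_{(1)},X_{(n)}]$, where $X_{(1)}=\min_i X_i$ and $X_{(n)}=\max_i X_i$.
   Context: $\mathcal{C}$ is the class of functions $\varphi:\mathbb{R}\to[-\infty,\infty)$ that are concave, closed (upper semicontinuous) and proper (not identically $-\infty$). $\mathcal{SC}_0$ is the class of $\psi\in\mathcal{C}$ with $\psi(x)=\psi(-x)$ for all $x$. The criterion function is $$\Psi_n(\theta,\psi)=\int_{-\infty}^\infty\psi(x-\theta)\,d\mathbb{F}_n(x)-\int_{-\infty}^\infty e^{\psi(x-\theta)}dx .$$ A maximizer $(\hat\theta_n,\hat\psi_n)$ of $\Psi_n$ over $\mathbb{R}\times\mathcal{SC}_0$ is called a maximum likelihood estimator (MLE) of $(\theta_0,\psi_0)$ in the model where the data have density $e^{\psi_0(\cdot-\theta_0)}$ with $\psi_0\in\mathcal{SC}_0$. Uniqueness of $\hat\theta_n$ is not claimed; $\hat\theta_n$ denotes any version of the MLE. *)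

theory Defs
  imports "HOL-Probability.Probability"
begin

(* Functions with values in [-\<infinity>, \<infinity>) are modelled as ereal-valued functions that avoid \<infinity>. *)

definition upper_semicontinuous :: "(real \<Rightarrow> ereal) \<Rightarrow> bool" where
  "upper_semicontinuous \<phi> \<longleftrightarrow> (\<forall>a. open {x. \<phi> x < a})"

(* No indeterminate sum arises in the inequality below when \<phi> avoids \<infinity>, and the
   boundary cases t = 0 and t = 1 are harmless since 0 * (-\<infinity>) = 0 in ereal. *)

definition concave_ereal :: "(real \<Rightarrow> ereal) \<Rightarrow> bool" where
  "concave_ereal \<phi> \<longleftrightarrow>
     (\<forall>x y. \<forall>t\<in>{0..1::real}.
        ereal (1 - t) * \<phi> x + ereal t * \<phi> y \<le> \<phi> ((1 - t) * x + t * y))"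

definition class_C :: "(real \<Rightarrow> ereal) set" where
  "class_C = {\<phi>. (\<forall>x. \<phi> x < \<infinity>) \<and> concave_ereal \<phi> \<and> upper_semicontinuous \<phi>
                 \<and> (\<exists>x. \<phi> x \<noteq> -\<infinity>)}"

definition class_SC0 :: "(real \<Rightarrow> ereal) set" where
  "class_SC0 = {\<psi> \<in> class_C. \<forall>x. \<psi> (- x) = \<psi> x}"

function exp_ereal :: "ereal \<Rightarrow> ennreal" where
  "exp_ereal (ereal r) = ennreal (exp r)"
| "exp_ereal \<infinity> = \<infinity>"
| "exp_ereal (-\<infinity>) = 0"
  by (auto intro: ereal_cases)
termination by (relation "{}") simp_all

(* Integral of the positive part minus integral of the negative part;
   e2ennreal sends negative arguments to 0. *)

definition integral_ereal :: "'a measure \<Rightarrow> ('a \<Rightarrow> ereal) \<Rightarrow> ereal" where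
  "integral_ereal M f =
     enn2ereal (\<integral>\<^sup>+ x. e2ennreal (f x) \<partial>M) - enn2ereal (\<integral>\<^sup>+ x. e2ennreal (- f x) \<partial>M)"

definition empirical_cdf :: "(nat \<Rightarrow> real) \<Rightarrow> nat \<Rightarrow> real \<Rightarrow> real" where
  "empirical_cdf X n x = real (card {i \<in> {1..n}. X i \<le> x}) / real n"

definition criterion :: "(nat \<Rightarrow> real) \<Rightarrow> nat \<Rightarrow> real \<Rightarrow> (real \<Rightarrow> ereal) \<Rightarrow> ereal" where
  "criterion X n \<theta> \<psi> =
     integral_ereal (interval_measure (empirical_cdf X n)) (\<lambda>x. \<psi> (x - \<theta>))
     - enn2ereal (\<integral>\<^sup>+ x. exp_ereal (\<psi> (x - \<theta>)) \<partial>lborel)"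

definition is_MLE :: "(nat \<Rightarrow> real) \<Rightarrow> nat \<Rightarrow> real \<Rightarrow> (real \<Rightarrow> ereal) \<Rightarrow> bool" where
  "is_MLE X n \<theta> \<psi> \<longleftrightarrow>
     \<psi> \<in> class_SC0 \<and>
     criterion X n \<theta> \<psi> = (SUP (\<theta>', \<psi>') \<in> UNIV \<times> class_SC0. criterion X n \<theta>' \<psi>')"

lemma class_C_measurable:
  assumes "\<phi> \<in> class_C"
  shows "\<phi> \<in> borel_measurable borel"
proof (rule borel_measurableI_less)
  fix a
  show "{x \<in> space borel. \<phi> x < a} \<in> sets borel"
    using assms by (auto simp: class_C_def upper_semicontinuous_def)
qed

lemma interval_measure_empirical_cdf:
  assumes "n \<ge> 1"
  shows "interval_measure (empirical_cdf X n) =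
         distr (measure_pmf (pmf_of_set {1..n})) borel X"
proof -
  let ?P = "measure_pmf (pmf_of_set {1..n})"
  let ?M = "distr ?P borel X"
  interpret M: real_distribution ?M
    by (intro prob_space.real_distribution_distr measure_pmf.prob_space_axioms) simp
  have cdf: "cdf ?M = empirical_cdf X n"
  proof
    fix x
    have "cdf ?M x = measure ?P (X -` {..x})"
      by (simp add: cdf_def measure_distr)
    also have "\<dots> = real (card ({1..n} \<inter> X -` {..x})) / real n"
      using assms by (subst measure_pmf_of_set) auto
    also have "{1..n} \<inter> X -` {..x} = {i \<in> {1..n}. X i \<le> x}"
      by auto
    finally show "cdf ?M x = empirical_cdf X n x"
      by (simp add: empirical_cdf_def)
  qed
  have props: "\<And>x y. x \<le> y \<Longrightarrow> empirical_cdf X n x \<le> empirical_cdf X n y"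
    "\<And>a. continuous (at_right a) (empirical_cdf X n)"
    "(empirical_cdf X n \<longlongrightarrow> 0) at_bot"
    "(empirical_cdf X n \<longlongrightarrow> 1) at_top"
    using M.cdf_nondecreasing M.cdf_is_right_cont M.cdf_lim_at_bot M.cdf_lim_at_top_prob
    unfolding cdf by auto
  show ?thesis
  proof (rule cdf_unique)
    show "real_distribution (interval_measure (empirical_cdf X n))"
      by (rule real_distribution_interval_measure) (fact props)+
    show "real_distribution ?M"
      by (fact M.real_distribution_axioms)
    show "cdf (interval_measure (empirical_cdf X n)) = cdf ?M"
      unfolding cdf by (rule cdf_interval_measure) (fact props)+
  qed
qed

lemma integral_ereal_empirical:
  assumes "n \<ge> 1" and f: "f \<in> borel_measurable borel" and fin: "\<And>x. f x < \<infinity>"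
  shows "integral_ereal (interval_measure (empirical_cdf X n)) f =
         (\<Sum>i=1..n. f (X i)) / ereal (real n)"
proof -
  have *: "(\<integral>\<^sup>+ x. g x \<partial>interval_measure (empirical_cdf X n)) = (\<Sum>i=1..n. g (X i)) / ennreal (real n)"
    if "g \<in> borel_measurable borel" for g
    using assms(1) that
    by (simp add: interval_measure_empirical_cdf nn_integral_distr nn_integral_pmf_of_set
          ennreal_of_nat_eq_real_of_nat)
  have I: "integral_ereal (interval_measure (empirical_cdf X n)) f =
      enn2ereal ((\<Sum>i=1..n. e2ennreal (f (X i))) / ennreal (real n))
      - enn2ereal ((\<Sum>i=1..n. e2ennreal (- f (X i))) / ennreal (real n))"
    using f by (simp add: integral_ereal_def *)
  have n0: "real n > 0" using assms(1) by simp
  show ?thesis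
  proof (cases "\<exists>i\<in>{1..n}. f (X i) = -\<infinity>")
    case False
    define r where "r i = real_of_ereal (f (X i))" for i
    have r: "f (X i) = ereal (r i)" if "i \<in> {1..n}" for i
      using False fin[of "X i"] that unfolding r_def by (cases "f (X i)") auto
    have pos: "e2ennreal (f (X i)) = ennreal (max 0 (r i))"
      and neg: "e2ennreal (- f (X i)) = ennreal (max 0 (- r i))" if "i \<in> {1..n}" for i
      using r[OF that] by (simp_all add: e2ennreal_ereal ennreal_neg max_def)
    have "(\<Sum>i=1..n. max 0 (r i)) / real n - (\<Sum>i=1..n. max 0 (- r i)) / real n
        = (\<Sum>i=1..n. r i) / real n"
      unfolding diff_divide_distrib[symmetric] sum_subtractf[symmetric]
      by (intro arg_cong2[of _ _ _ _ "(/)"] sum.cong) auto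
    moreover have "(\<Sum>i=1..n. e2ennreal (f (X i))) = ennreal (\<Sum>i=1..n. max 0 (r i))"
      by (subst sum_ennreal[symmetric]) (auto intro!: sum.cong simp: pos)
    moreover have "(\<Sum>i=1..n. e2ennreal (- f (X i))) = ennreal (\<Sum>i=1..n. max 0 (- r i))"
      by (subst sum_ennreal[symmetric]) (auto intro!: sum.cong simp: neg)
    moreover have "(\<Sum>i=1..n. f (X i)) = ereal (\<Sum>i=1..n. r i)"
      by (subst sum_ereal[symmetric]) (auto intro!: sum.cong simp: r)
    ultimately show ?thesis
      unfolding I using n0
      by (simp add: divide_ennreal sum_nonneg enn2ereal_ennreal del: One_nat_def)
  next
    case True
    then obtain j where j: "j \<in> {1..n}" "f (X j) = -\<infinity>" by auto
    have "(\<Sum>i=1..n. e2ennreal (- f (X i))) = top"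
      using j by (auto intro!: bexI[of _ j])
    moreover have "e2ennreal (f (X i)) \<noteq> top" for i
      using fin[of "X i"] by (cases "f (X i)") (auto simp: e2ennreal_neg)
    then have "(\<Sum>i=1..n. e2ennreal (f (X i))) \<noteq> top"
      by simp
    then obtain p where "p \<ge> 0" "(\<Sum>i=1..n. e2ennreal (f (X i))) = ennreal p"
      by (metis ennreal_cases)
    moreover have "(\<Sum>i\<in>{1..n} - {j}. f (X i)) \<noteq> \<infinity>"
      using fin by (auto simp: sum_Pinfty less_top[symmetric] top_ereal_def)
    then have "(\<Sum>i=1..n. f (X i)) = -\<infinity>"
      using j by (simp add: sum.remove[of _ j])
    ultimately show ?thesis
      unfolding I using n0
      by (simp only:) (simp add: ennreal_top_divide divide_ennreal enn2ereal_ennreal)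
  qed
qed

end

theory Submission
  imports Defs "HOL-Real_Asymp.Real_Asymp"
begin

text \<open>Members of the class are nonincreasing in \<open>\<bar>x\<bar>\<close>. Hence if \<open>\<theta>\<close> lies outside the range
  \<open>[a, b]\<close> of the data, projecting it to \<open>[a, b]\<close> and cutting \<open>\<psi>\<close> off outside \<open>[-(b - a), b - a]\<close>
  does not decrease the sum and strictly decreases the integral.

  For existence take a maximizing sequence with \<open>\<theta>\<^sub>k \<in> [a, b]\<close>. Some observation is at distance at
  least \<open>\<delta> > 0\<close> from \<open>\<theta>\<^sub>k\<close>, so concavity bounds the integral below by a multiple of
  \<open>exp M / (1 + s)\<close>, where \<open>M = \<psi>\<^sub>k 0\<close> and \<open>s\<close> is the drop of \<open>\<psi>\<^sub>k\<close> to that observation; as \<open>s\<close> is at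
  most linear in \<open>M\<close>, this bounds \<open>M\<close> and the values at the observations. Along a subsequence
  \<open>\<theta>\<^sub>k\<close> and these values converge. The pointwise liminf of the \<open>\<psi>\<^sub>k\<close> is concave (a limsup need not
  be), Fatou's lemma controls its integral, and monotonicity in \<open>\<bar>x\<bar>\<close> shows that its closure
  dominates the limit values.\<close>

section \<open>The exponential on the extended reals\<close>

lemma exp_ereal_strict_mono: "x < y \<Longrightarrow> exp_ereal x < exp_ereal y"
  by (cases x; cases y) (auto simp: ennreal_less_iff)

lemma exp_ereal_mono: "x \<le> y \<Longrightarrow> exp_ereal x \<le> exp_ereal y"
  using exp_ereal_strict_mono[of x y] by (auto simp: le_less)

lemma exp_ereal_less_iff: "exp_ereal x < exp_ereal y \<longleftrightarrow> x < y"
  using exp_ereal_strict_mono[of x y] exp_ereal_mono[of y x] by (meson not_le)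

text \<open>Every threshold in \<open>ennreal\<close> becomes some \<open>exp_ereal d\<close>, so
  that inequalities for \<open>exp_ereal\<close> can be pulled back to its argument. Measurability
  and the liminf inequality below both rest on this.\<close>

lemma exp_ereal_surj: "\<exists>d. exp_ereal d = c"
proof (cases c)
  case (real r)
  show ?thesis
  proof (cases "r = 0")
    case True
    then show ?thesis using real by (intro exI[of _ "-\<infinity>"]) simp
  next
    case False
    then show ?thesis using real by (intro exI[of _ "ereal (ln r)"]) simp
  qed
next
  case top
  then show ?thesis by (intro exI[of _ \<infinity>]) simp
qed

lemma measurable_exp_ereal [measurable]: "exp_ereal \<in> borel_measurable borel"
proof (rule borel_measurableI_less)
  fix c
  obtain d where d: "exp_ereal d = c" using exp_ereal_surj by blast
  show "{x \<in> space borel. exp_ereal x < c} \<in> sets borel"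
    unfolding d[symmetric] exp_ereal_less_iff by simp
qed

text \<open>Prepares Fatou's lemma for a pointwise liminf of log-densities. No continuity is
  involved: \<open>exp_ereal\<close> is an order isomorphism, so thresholds below the left side
  transfer directly.\<close>

lemma exp_ereal_liminf_le: "exp_ereal (liminf u) \<le> liminf (\<lambda>k. exp_ereal (u k))"
  unfolding le_Liminf_iff
proof (intro allI impI)
  fix c assume c: "c < exp_ereal (liminf u)"
  obtain d where d: "exp_ereal d = c" using exp_ereal_surj by blast
  show "\<forall>\<^sub>F k in sequentially. c < exp_ereal (u k)"
    using c unfolding d[symmetric] exp_ereal_less_iff by (rule less_LiminfD)
qed

section \<open>Even concave functions: monotonicity, limits, truncation, closure\<close>

text \<open>The point \<open>x\<close> lies on the segment from \<open>- y\<close> to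
  \<open>y\<close>, at whose two ends the function has the same value.\<close>

lemma concave_even_antimono:
  fixes \<psi> :: "real \<Rightarrow> ereal"
  assumes c: "concave_ereal \<psi>" and e: "\<And>x. \<psi> (- x) = \<psi> x" and le: "\<bar>x\<bar> \<le> \<bar>y\<bar>"
  shows "\<psi> y \<le> \<psi> x"
proof (cases "y = 0")
  case True
  then show ?thesis using le by simp
next
  case False
  define q where "q = x / y"
  define t where "t = (q + 1) / 2"
  have "\<bar>q\<bar> \<le> 1" using le False by (simp add: q_def)
  then have t: "t \<in> {0..1}" by (auto simp: t_def)
  have x: "x = (1 - t) * (- y) + t * y" using False by (simp add: t_def q_def field_simps)
  have "\<psi> y = ereal (1 - t) * \<psi> y + ereal t * \<psi> y"
    using t by (cases "\<psi> y") (auto simp: algebra_simps)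
  also have "\<dots> = ereal (1 - t) * \<psi> (- y) + ereal t * \<psi> y"
    by (simp add: e)
  also have "\<dots> \<le> \<psi> x"
    using c t unfolding concave_ereal_def x by blast
  finally show ?thesis .
qed

lemma class_SC0_antimono: "\<psi> \<in> class_SC0 \<Longrightarrow> \<bar>x\<bar> \<le> \<bar>y\<bar> \<Longrightarrow> \<psi> y \<le> \<psi> x"
  by (rule concave_even_antimono) (auto simp: class_SC0_def class_C_def)

lemma class_SC0_le_0: "\<psi> \<in> class_SC0 \<Longrightarrow> \<psi> x \<le> \<psi> 0"
  by (rule class_SC0_antimono) auto

lemma class_SC0_measurable [measurable_dest]:
  "\<psi> \<in> class_SC0 \<Longrightarrow> \<psi> \<in> borel_measurable borel"
  by (rule class_C_measurable) (simp add: class_SC0_def)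

text \<open>The liminf is superadditive. The common bound \<open>K\<close> keeps it away from
  \<infinity>, so that no sum of opposite infinities arises.\<close>

lemma concave_ereal_liminf:
  fixes \<psi> :: "nat \<Rightarrow> real \<Rightarrow> ereal"
  assumes c: "\<And>k. concave_ereal (\<psi> k)" and bd: "\<And>k x. \<psi> k x \<le> ereal K"
  shows "concave_ereal (\<lambda>x. liminf (\<lambda>k. \<psi> k x))"
  unfolding concave_ereal_def
proof (intro allI ballI)
  fix x y t :: real assume t: "t \<in> {0..1}"
  have fin: "liminf (\<lambda>k. ereal c * \<psi> k x) \<noteq> \<infinity>" if "c \<ge> 0" for c x
  proof -
    have "liminf (\<lambda>k. ereal c * \<psi> k x) \<le> ereal c * ereal K"
      using that bd by (intro Liminf_le always_eventually allI ereal_mult_left_mono) auto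
    then show ?thesis by auto
  qed
  have "ereal (1 - t) * liminf (\<lambda>k. \<psi> k x) + ereal t * liminf (\<lambda>k. \<psi> k y) =
      liminf (\<lambda>k. ereal (1 - t) * \<psi> k x) + liminf (\<lambda>k. ereal t * \<psi> k y)"
    using t by (simp add: Liminf_ereal_mult_left)
  also have "\<dots> \<le> liminf (\<lambda>k. ereal (1 - t) * \<psi> k x + ereal t * \<psi> k y)"
    using t fin by (intro ereal_liminf_add_mono) auto
  also have "\<dots> \<le> liminf (\<lambda>k. \<psi> k ((1 - t) * x + t * y))"
    using c t by (intro Liminf_mono always_eventually) (auto simp: concave_ereal_def)
  finally show "ereal (1 - t) * liminf (\<lambda>k. \<psi> k x) + ereal t * liminf (\<lambda>k. \<psi> k y)
      \<le> liminf (\<lambda>k. \<psi> k ((1 - t) * x + t * y))" .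
qed

text \<open>The interval [-r, r] is convex, closed and symmetric, which preserves concavity, upper
  semicontinuity and evenness respectively; it contains 0, where the value is finite, so the result
  stays proper.\<close>

lemma truncate_class_SC0:
  assumes \<psi>: "\<psi> \<in> class_SC0" and r: "r \<ge> 0" and "\<psi> 0 \<noteq> -\<infinity>"
  shows "(\<lambda>x. if \<bar>x\<bar> \<le> r then \<psi> x else -\<infinity>) \<in> class_SC0"
    (is "?\<phi> \<in> _")
proof -
  have "concave_ereal ?\<phi>"
    unfolding concave_ereal_def
  proof (intro allI ballI)
    fix x y t :: real assume t: "t \<in> {0..1}"
    have c: "ereal (1 - t) * \<psi> x + ereal t * \<psi> y \<le> \<psi> ((1 - t) * x + t * y)"
      using \<psi> t by (auto simp: class_SC0_def class_C_def concave_ereal_def)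
    have fin: "\<psi> z \<noteq> \<infinity>" for z using \<psi> by (auto simp: class_SC0_def class_C_def)
    \<comment> \<open>The end weights are separate because 0 * (-\<infinity>) = 0: only a positive
      weight lets a point outside the interval force the left side to -\<infinity>.\<close>
    consider "t = 0" | "t = 1" | "0 < t" "t < 1" using t by force
    then show "ereal (1 - t) * ?\<phi> x + ereal t * ?\<phi> y \<le> ?\<phi> ((1 - t) * x + t * y)"
    proof cases
      case 3
      show ?thesis
      proof (cases "\<bar>x\<bar> \<le> r \<and> \<bar>y\<bar> \<le> r")
        case True
        have "\<bar>(1 - t) * x + t * y\<bar> \<le> (1 - t) * \<bar>x\<bar> + t * \<bar>y\<bar>"
          using t abs_triangle_ineq[of "(1 - t) * x" "t * y"] by (simp add: abs_mult)
        also have "\<dots> \<le> (1 - t) * r + t * r"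
          using True t by (intro add_mono mult_left_mono) auto
        finally have "\<bar>(1 - t) * x + t * y\<bar> \<le> r" by (simp add: algebra_simps)
        then show ?thesis using True c by simp
      next
        case False
        then have "ereal (1 - t) * ?\<phi> x + ereal t * ?\<phi> y = -\<infinity>"
          using 3 fin[of x] fin[of y] by (cases "\<psi> x"; cases "\<psi> y") auto
        then show ?thesis by (simp only:) simp
      qed
    qed (simp_all flip: zero_ereal_def one_ereal_def)
  qed
  moreover have "upper_semicontinuous ?\<phi>"
    unfolding upper_semicontinuous_def
  proof
    fix a
    show "open {x. ?\<phi> x < a}"
    proof (cases "a = -\<infinity>")
      case False
      then have "{x. ?\<phi> x < a} = {x. \<psi> x < a} \<union> {x. \<bar>x\<bar> > r}"
        by (auto simp: less_le)
      moreover have "open {x. \<psi> x < a}"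
        using \<psi> by (auto simp: class_SC0_def class_C_def upper_semicontinuous_def)
      moreover have "open {x::real. \<bar>x\<bar> > r}"
        by (intro open_Collect_less continuous_intros)
      ultimately show ?thesis by auto
    qed simp
  qed
  moreover have "\<exists>x. ?\<phi> x \<noteq> -\<infinity>" using assms by (intro exI[of _ 0]) simp
  ultimately show ?thesis using \<psi> by (auto simp: class_SC0_def class_C_def)
qed

text \<open>Taking radial limits from inside closes an even concave function; since
  \<open>\<integral> exp (\<phi> (t x)) dx = (1/t) \<integral> exp (\<phi> x) dx\<close>, letting \<open>t\<close> tend to 1 shows that the
  closure does not increase the integral.\<close>

lemma radial_closure:
  fixes \<phi> :: "real \<Rightarrow> ereal"
  assumes c: "concave_ereal \<phi>" and e: "\<And>x. \<phi> (- x) = \<phi> x" and b: "\<phi> 0 < \<infinity>" and ne: "\<phi> 0 \<noteq> -\<infinity>"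
    and m: "\<phi> \<in> borel_measurable borel"
  defines "\<psi> \<equiv> \<lambda>x. INF t\<in>{0..<1}. \<phi> (t * x)"
  shows "\<psi> \<in> class_SC0" "(\<integral>\<^sup>+x. exp_ereal (\<psi> x) \<partial>lborel) \<le> (\<integral>\<^sup>+x. exp_ereal (\<phi> x) \<partial>lborel)"
proof -
  have \<psi>_le: "\<psi> x \<le> \<phi> (t * x)" if "t \<in> {0..<1}" for t x
    unfolding \<psi>_def using that by (rule INF_lower)
  have \<psi>0: "\<psi> 0 = \<phi> 0" unfolding \<psi>_def by simp
  have "concave_ereal \<psi>"
    unfolding concave_ereal_def
  proof (intro allI ballI)
    fix x y s :: real assume s: "s \<in> {0..1}"
    show "ereal (1 - s) * \<psi> x + ereal s * \<psi> y \<le> \<psi> ((1 - s) * x + s * y)"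
      unfolding \<psi>_def[of] 
    proof (rule INF_greatest)
      fix t :: real assume t: "t \<in> {0..<1}"
      have "ereal (1 - s) * \<psi> x + ereal s * \<psi> y \<le> ereal (1 - s) * \<phi> (t * x) + ereal s * \<phi> (t * y)"
        using s t by (intro add_mono ereal_mult_left_mono \<psi>_le) auto
      also have "\<dots> \<le> \<phi> ((1 - s) * (t * x) + s * (t * y))"
        using c s unfolding concave_ereal_def by blast
      also have "(1 - s) * (t * x) + s * (t * y) = t * ((1 - s) * x + s * y)"
        by (simp add: algebra_simps)
      finally show "ereal (1 - s) * (INF t\<in>{0..<1}. \<phi> (t * x)) + ereal s * (INF t\<in>{0..<1}. \<phi> (t * y))
          \<le> \<phi> (t * ((1 - s) * x + s * y))"
        by (simp add: \<psi>_def)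
    qed
  qed
  moreover have "\<psi> (- x) = \<psi> x" for x
    by (simp add: \<psi>_def e)
  moreover have "upper_semicontinuous \<psi>"
    unfolding upper_semicontinuous_def
  proof
    fix a
    have "\<exists>A. open A \<and> x \<in> A \<and> A \<subseteq> {x. \<psi> x < a}" if x: "\<psi> x < a" for x
    proof -
      obtain t where t: "t \<in> {0..<1}" "\<phi> (t * x) < a"
        using x unfolding \<psi>_def INF_less_iff by blast
      show ?thesis
      proof (cases "x = 0")
        case True
        have "\<psi> y < a" for y
          using \<psi>_le[of 0 y] t True by simp
        then show ?thesis by (intro exI[of _ UNIV]) auto
      next
        case False
        \<comment> \<open>Such a \<open>y\<close> can be shrunk by a factor below 1 to the radius
          \<open>t * \<bar>x\<bar>\<close>, where \<open>\<phi>\<close> is already below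
          \<open>a\<close>. As t < 1, these \<open>y\<close> form an open neighbourhood of
          \<open>x\<close>.\<close>
        have "\<psi> y < a" if y: "\<bar>y\<bar> > t * \<bar>x\<bar>" for y
        proof -
          have y0: "\<bar>y\<bar> > 0" using y t by (smt (verit) mult_nonneg_nonneg atLeastLessThan_iff abs_ge_zero)
          define s where "s = t * \<bar>x\<bar> / \<bar>y\<bar>"
          have s: "s \<in> {0..<1}" using y y0 t by (auto simp: s_def divide_simps)
          have "\<phi> (s * y) \<le> \<phi> (t * x)"
            using y0 t by (intro concave_even_antimono[OF c e]) (auto simp: s_def abs_mult)
          then show ?thesis using \<psi>_le[OF s, of y] t by simp
        qed
        moreover have "open {y::real. \<bar>y\<bar> > t * \<bar>x\<bar>}"
          by (intro open_Collect_less continuous_intros)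
        moreover have "x \<in> {y. \<bar>y\<bar> > t * \<bar>x\<bar>}" using t False by simp
        ultimately show ?thesis by (intro exI[of _ "{y. \<bar>y\<bar> > t * \<bar>x\<bar>}"]) auto
      qed
    qed
    then show "open {x. \<psi> x < a}"
      by (subst open_subopen) auto
  qed
  moreover have "\<psi> x < \<infinity>" for x
    using \<psi>_le[of 0 x] b by (auto simp: less_top[symmetric] top_ereal_def)
  moreover have "\<exists>x. \<psi> x \<noteq> -\<infinity>"
    using ne \<psi>0 by (intro exI[of _ 0]) simp
  ultimately show "\<psi> \<in> class_SC0"
    by (simp add: class_SC0_def class_C_def)
  show "(\<integral>\<^sup>+x. exp_ereal (\<psi> x) \<partial>lborel) \<le> (\<integral>\<^sup>+x. exp_ereal (\<phi> x) \<partial>lborel)" (is "?J \<le> ?I")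
  proof -
    have tJ: "ennreal t * ?J \<le> ?I" if t: "t \<in> {0<..<1}" for t
    proof -
      have "?I = ennreal \<bar>t\<bar> * (\<integral>\<^sup>+x. exp_ereal (\<phi> (0 + t * x)) \<partial>lborel)"
        using m t by (intro nn_integral_real_affine) auto
      moreover have "?J \<le> (\<integral>\<^sup>+x. exp_ereal (\<phi> (0 + t * x)) \<partial>lborel)"
        using t by (intro nn_integral_mono exp_ereal_mono) (auto intro!: \<psi>_le)
      ultimately show ?thesis using t by (auto intro!: mult_left_mono)
    qed
    have "((\<lambda>t. ennreal t * ?J) \<longlongrightarrow> ennreal 1 * ?J) (at_left (1::real))"
    proof (cases "?J = top")
      case True
      have "ennreal 1 * ?J = top" using True by simp
      moreover have "\<forall>\<^sub>F t in at_left (1::real). ennreal t * ?J = top"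
        unfolding True using eventually_at_left_real[OF zero_less_one]
        by (rule eventually_mono) (simp add: ennreal_mult_top)
      ultimately show ?thesis by (simp only: tendsto_eventually)
    next
      case False
      then show ?thesis
        by (intro tendsto_mult_ennreal tendsto_ennrealI tendsto_const tendsto_ident_at) auto
    qed
    then have "ennreal 1 * ?J \<le> ?I"
      by (rule tendsto_upperbound)
        (auto intro: eventually_mono[OF eventually_at_left_real[OF zero_less_one] tJ])
    then show ?thesis by simp
  qed
qed


text \<open>By monotonicity in \<bar>x\<bar> the bound at \<open>q\<close> holds on all of [-q, q],
  so a rectangle of width 2q and height exp c fits under the density.\<close>

lemma nn_integral_exp_ge:
  assumes \<psi>: "\<psi> \<in> class_SC0" and q: "q \<ge> 0" and c: "ereal c \<le> \<psi> q"
  shows "ennreal (2 * q * exp c) \<le> (\<integral>\<^sup>+x. exp_ereal (\<psi> x) \<partial>lborel)"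
proof -
  have "ennreal (2 * q * exp c) = (\<integral>\<^sup>+x. ennreal (exp c) * indicator {-q..q} x \<partial>lborel)"
    using q by (simp add: nn_integral_cmult_indicator ennreal_mult' mult.commute)
  also have "\<dots> \<le> (\<integral>\<^sup>+x. exp_ereal (\<psi> x) \<partial>lborel)"
  proof (rule nn_integral_mono)
    fix x
    have "ennreal (exp c) \<le> exp_ereal (\<psi> x)" if "x \<in> {-q..q}"
    proof -
      have "\<psi> q \<le> \<psi> x" using that by (intro class_SC0_antimono[OF \<psi>]) auto
      then have "exp_ereal (ereal c) \<le> exp_ereal (\<psi> x)"
        using c by (intro exp_ereal_mono) simp
      then show ?thesis by simp
    qed
    then show "ennreal (exp c) * indicator {-q..q} x \<le> exp_ereal (\<psi> x)"
      by (auto simp: indicator_def)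
  qed
  finally show ?thesis .
qed

section \<open>The criterion as a finite average minus an integral\<close>

text \<open>Translation invariance of Lebesgue measure removes \<open>\<theta>\<close> from the
  integral; the location enters only through the residuals.\<close>

lemma criterion_eq:
  assumes n: "n \<ge> 1" and \<psi>: "\<psi> \<in> class_SC0"
  shows "criterion X n \<theta> \<psi> =
    (\<Sum>i=1..n. \<psi> (X i - \<theta>)) / ereal (real n) - enn2ereal (\<integral>\<^sup>+x. exp_ereal (\<psi> x) \<partial>lborel)"
proof -
  have [measurable]: "\<psi> \<in> borel_measurable borel" using \<psi> by (rule class_SC0_measurable)
  have fin: "\<And>x. \<psi> x < \<infinity>" using \<psi> by (auto simp: class_SC0_def class_C_def)
  have "(\<integral>\<^sup>+x. exp_ereal (\<psi> x) \<partial>lborel) = ennreal \<bar>1\<bar> * (\<integral>\<^sup>+x. exp_ereal (\<psi> (- \<theta> + 1 * x)) \<partial>lborel)"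
    by (intro nn_integral_real_affine) auto
  then have "(\<integral>\<^sup>+x. exp_ereal (\<psi> x) \<partial>lborel) = (\<integral>\<^sup>+x. exp_ereal (\<psi> (x - \<theta>)) \<partial>lborel)"
    by simp
  then show ?thesis
    unfolding criterion_def using fin
    by (subst integral_ereal_empirical[OF n]) auto
qed

lemma criterion_eq_real:
  assumes n: "n \<ge> 1" and \<psi>: "\<psi> \<in> class_SC0"
    and y: "\<forall>i\<in>{1..n}. \<psi> (X i - \<theta>) = ereal (y i)"
    and I: "(\<integral>\<^sup>+x. exp_ereal (\<psi> x) \<partial>lborel) = ennreal I" "I \<ge> 0"
  shows "criterion X n \<theta> \<psi> = ereal ((\<Sum>i=1..n. y i) / real n - I)"
  using n y I by (simp add: criterion_eq[OF n \<psi>] enn2ereal_ennreal)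

text \<open>A value -\<infinity> at one observation, or an infinite integral, would already make the
  criterion -\<infinity>. Hence everything can be named by real numbers.\<close>

lemma criterion_finiteE:
  assumes n: "n \<ge> 1" and \<psi>: "\<psi> \<in> class_SC0" and cr: "criterion X n \<theta> \<psi> > -\<infinity>"
  obtains y I where "\<And>i. i \<in> {1..n} \<Longrightarrow> \<psi> (X i - \<theta>) = ereal (y i)"
    "(\<integral>\<^sup>+x. exp_ereal (\<psi> x) \<partial>lborel) = ennreal I" "I \<ge> 0"
    "criterion X n \<theta> \<psi> = ereal ((\<Sum>i=1..n. y i) / real n - I)"
proof -
  have fin: "\<psi> x \<noteq> \<infinity>" for x using \<psi> by (auto simp: class_SC0_def class_C_def)
  \<comment> \<open>This includes c = top, so an observation of value -\<infinity> decides the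
    criterion whatever the integral is.\<close>
  have minf: "-\<infinity> - enn2ereal c = -\<infinity>" for c
    by (cases c) (auto simp: enn2ereal_ennreal)
  have sum_fin: "(\<Sum>i\<in>S. \<psi> (X i - \<theta>)) \<noteq> \<infinity>" for S
    using fin by (auto simp: sum_Pinfty)
  have n0: "real n > 0" using n by simp
  have "\<exists>r. \<psi> (X i - \<theta>) = ereal r" if i: "i \<in> {1..n}" for i
  proof (rule ccontr)
    assume "\<not> ?thesis"
    then have "\<psi> (X i - \<theta>) = -\<infinity>" using fin by (cases "\<psi> (X i - \<theta>)") auto
    then have "(\<Sum>i=1..n. \<psi> (X i - \<theta>)) = -\<infinity>"
      using i sum_fin[of "{1..n} - {i}"] by (simp add: sum.remove[of _ i])
    then have "criterion X n \<theta> \<psi> = -\<infinity>"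
      using n0 minf by (simp add: criterion_eq[OF n \<psi>])
    then show False using cr by simp
  qed
  then obtain y where y: "\<And>i. i \<in> {1..n} \<Longrightarrow> \<psi> (X i - \<theta>) = ereal (y i)" by metis
  have "(\<integral>\<^sup>+x. exp_ereal (\<psi> x) \<partial>lborel) \<noteq> top"
  proof
    assume "(\<integral>\<^sup>+x. exp_ereal (\<psi> x) \<partial>lborel) = top"
    then have "criterion X n \<theta> \<psi> = -\<infinity>"
      using n0 y by (simp add: criterion_eq[OF n \<psi>])
    then show False using cr by simp
  qed
  then obtain I where I: "(\<integral>\<^sup>+x. exp_ereal (\<psi> x) \<partial>lborel) = ennreal I" "I \<ge> 0"
    by (metis ennreal_cases)
  have "\<forall>i\<in>{1..n}. \<psi> (X i - \<theta>) = ereal (y i)" using y by blast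
  from that[OF y I criterion_eq_real[OF n \<psi> this I]] show ?thesis by blast
qed

section \<open>Moving the location into the range of the data\<close>

text \<open>Smaller residuals do not lower \<open>\<psi>\<close>, and a cut-off at \<open>r\<close>
  keeps all the new ones. The gain is strict because the old residual of \<open>X j\<close> lies
  beyond \<open>r\<close> and has a finite value, so the cut removes positive mass.\<close>

lemma criterion_truncate_less:
  assumes n: "n \<ge> 1" and \<psi>: "\<psi> \<in> class_SC0" and cr: "criterion X n \<theta> \<psi> > -\<infinity>"
    and closer: "\<And>i. i \<in> {1..n} \<Longrightarrow> \<bar>X i - \<theta>'\<bar> \<le> \<bar>X i - \<theta>\<bar>"
    and r: "\<And>i. i \<in> {1..n} \<Longrightarrow> \<bar>X i - \<theta>'\<bar> \<le> r"
    and j: "j \<in> {1..n}" "\<bar>X j - \<theta>\<bar> > r" and r0: "r \<ge> 0"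
  shows "\<exists>\<psi>'\<in>class_SC0. criterion X n \<theta> \<psi> < criterion X n \<theta>' \<psi>'"
proof -
  obtain y I where y: "\<And>i. i \<in> {1..n} \<Longrightarrow> \<psi> (X i - \<theta>) = ereal (y i)"
    and I: "(\<integral>\<^sup>+x. exp_ereal (\<psi> x) \<partial>lborel) = ennreal I" "I \<ge> 0"
    and cr_eq: "criterion X n \<theta> \<psi> = ereal ((\<Sum>i=1..n. y i) / real n - I)"
    using criterion_finiteE[OF n \<psi> cr] by blast
  have fin: "\<psi> x \<noteq> \<infinity>" for x using \<psi> by (auto simp: class_SC0_def class_C_def)
  define \<phi> where "\<phi> = (\<lambda>x. if \<bar>x\<bar> \<le> r then \<psi> x else -\<infinity>)"
  have ne: "\<psi> 0 \<noteq> -\<infinity>"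
    using class_SC0_le_0[OF \<psi>, of "X j - \<theta>"] y[OF j(1)] by auto
  have \<phi>: "\<phi> \<in> class_SC0"
    unfolding \<phi>_def by (rule truncate_class_SC0[OF \<psi> r0 ne])
  have [measurable]: "\<phi> \<in> borel_measurable borel" using \<phi> by (rule class_SC0_measurable)
  have \<phi>_ge: "\<phi> (X i - \<theta>') \<ge> ereal (y i)" if i: "i \<in> {1..n}" for i
    using class_SC0_antimono[OF \<psi> closer[OF i]] r[OF i] y[OF i] by (simp add: \<phi>_def)
  have \<phi>_fin: "\<phi> x \<noteq> \<infinity>" for x using fin by (auto simp: \<phi>_def)
  define z where "z i = real_of_ereal (\<phi> (X i - \<theta>'))" for i
  have z: "\<phi> (X i - \<theta>') = ereal (z i)" if "i \<in> {1..n}" for i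
    using \<phi>_ge[OF that] \<phi>_fin[of "X i - \<theta>'"] unfolding z_def by (cases "\<phi> (X i - \<theta>')") auto
  have zy: "y i \<le> z i" if "i \<in> {1..n}" for i using z[OF that] \<phi>_ge[OF that] by simp
  define D where "D = \<bar>X j - \<theta>\<bar>"
  have D: "r < D" using j by (simp add: D_def)
  \<comment> \<open>A lower bound for the lost mass: on (r, D] the function \<open>\<psi>\<close> is
    at least \<open>y j\<close>. The loss is added on the smaller side, which avoids subtraction in
    \<open>ennreal\<close>.\<close>
  define e where "e = (D - r) * exp (y j)"
  have e0: "e > 0" using D by (simp add: e_def)
  have "(\<integral>\<^sup>+x. exp_ereal (\<phi> x) \<partial>lborel) + ennreal e =
      (\<integral>\<^sup>+x. exp_ereal (\<phi> x) \<partial>lborel) + (\<integral>\<^sup>+x. ennreal (exp (y j)) * indicator {r<..D} x \<partial>lborel)"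
    using D by (simp add: nn_integral_cmult_indicator e_def ennreal_mult' mult.commute)
  also have "\<dots> = (\<integral>\<^sup>+x. exp_ereal (\<phi> x) + ennreal (exp (y j)) * indicator {r<..D} x \<partial>lborel)"
    by (rule nn_integral_add[symmetric]) auto
  also have "\<dots> \<le> (\<integral>\<^sup>+x. exp_ereal (\<psi> x) \<partial>lborel)"
  proof (rule nn_integral_mono)
    fix x
    show "exp_ereal (\<phi> x) + ennreal (exp (y j)) * indicator {r<..D} x \<le> exp_ereal (\<psi> x)"
    proof (cases "x \<in> {r<..D}")
      case True
      have "\<psi> (X j - \<theta>) \<le> \<psi> x"
        using True r0 by (intro class_SC0_antimono[OF \<psi>]) (auto simp: D_def)
      then have "exp_ereal (ereal (y j)) \<le> exp_ereal (\<psi> x)"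
        using y[OF j(1)] by (intro exp_ereal_mono) simp
      then show ?thesis using True r0 by (simp add: \<phi>_def)
    next
      case False
      then show ?thesis by (auto simp: \<phi>_def)
    qed
  qed
  finally have le: "(\<integral>\<^sup>+x. exp_ereal (\<phi> x) \<partial>lborel) + ennreal e \<le> ennreal I"
    by (simp add: I)
  then have "(\<integral>\<^sup>+x. exp_ereal (\<phi> x) \<partial>lborel) \<noteq> top"
    by (auto simp: top_unique)
  then obtain J where J: "(\<integral>\<^sup>+x. exp_ereal (\<phi> x) \<partial>lborel) = ennreal J" "J \<ge> 0"
    by (metis ennreal_cases)
  have "J + e \<le> I"
    using le e0 I(2) unfolding J(1) by (simp add: J(2) flip: ennreal_plus)
  moreover have "(\<Sum>i=1..n. y i) / real n \<le> (\<Sum>i=1..n. z i) / real n"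
    using zy by (intro divide_right_mono sum_mono) auto
  moreover have "criterion X n \<theta>' \<phi> = ereal ((\<Sum>i=1..n. z i) / real n - J)"
    using z by (intro criterion_eq_real[OF n \<phi> _ J]) blast
  ultimately have "criterion X n \<theta> \<psi> < criterion X n \<theta>' \<phi>"
    using e0 unfolding cr_eq by simp
  then show ?thesis using \<phi> by blast
qed

lemma criterion_outside_range:
  assumes n: "n \<ge> 1" and \<psi>: "\<psi> \<in> class_SC0" and cr: "criterion X n \<theta> \<psi> > -\<infinity>"
    and out: "\<theta> \<notin> {Min (X ` {1..n})..Max (X ` {1..n})}"
  shows "\<exists>\<theta>'\<in>{Min (X ` {1..n})..Max (X ` {1..n})}. \<exists>\<psi>'\<in>class_SC0.
    criterion X n \<theta> \<psi> < criterion X n \<theta>' \<psi>'"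
proof -
  define a where "a = Min (X ` {1..n})"
  define b where "b = Max (X ` {1..n})"
  have ne: "X ` {1..n} \<noteq> {}" using n by simp
  have "a \<in> X ` {1..n}" "b \<in> X ` {1..n}"
    unfolding a_def b_def by (intro Min_in Max_in finite_imageI finite_atLeastAtMost ne)+
  then obtain i\<^sub>a i\<^sub>b where ia: "i\<^sub>a \<in> {1..n}" "X i\<^sub>a = a" and ib: "i\<^sub>b \<in> {1..n}" "X i\<^sub>b = b"
    by blast
  have ab: "a \<le> X i" "X i \<le> b" if "i \<in> {1..n}" for i
    using that by (auto simp: a_def b_def)
  have le: "a \<le> b" using ab[OF ia(1)] by simp
  define \<theta>' where "\<theta>' = max a (min b \<theta>)"
  have out': "\<theta> < a \<or> b < \<theta>" using out by (auto simp: a_def b_def)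
  \<comment> \<open>The extreme observation on the far side from \<open>\<theta>\<close> is more
    than the whole range away.\<close>
  then obtain j where j: "j \<in> {1..n}" "\<bar>X j - \<theta>\<bar> > b - a"
  proof
    assume "\<theta> < a" then show ?thesis using that[of i\<^sub>b] ib by simp
  next
    assume "b < \<theta>" then show ?thesis using that[of i\<^sub>a] ia by simp
  qed
  have "\<exists>\<psi>'\<in>class_SC0. criterion X n \<theta> \<psi> < criterion X n \<theta>' \<psi>'"
  proof (rule criterion_truncate_less[OF n \<psi> cr _ _ j])
    fix i assume "i \<in> {1..n}"
    note ab[OF this]
    then show "\<bar>X i - \<theta>'\<bar> \<le> \<bar>X i - \<theta>\<bar>" "\<bar>X i - \<theta>'\<bar> \<le> b - a"
      unfolding \<theta>'_def by linarith+
  qed (use le in simp)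
  moreover have "\<theta>' \<in> {a..b}" using le by (auto simp: \<theta>'_def)
  ultimately show ?thesis unfolding a_def b_def by blast
qed

section \<open>A priori bounds and passage to the limit\<close>

text \<open>Supplies compactness, uniformly in \<open>\<theta>\<close>: a high peak forces either a
  large integral or a steep drop to some observation, and exponential growth of the former beats
  what the latter can save.\<close>

lemma criterion_superlevel_bounds:
  assumes ij: "i \<in> {1..n}" "j \<in> {1..n}" "X i \<noteq> X j"
  shows "\<exists>K. \<forall>\<theta>. \<forall>\<psi>\<in>class_SC0. criterion X n \<theta> \<psi> \<ge> ereal L \<longrightarrow>
    \<psi> 0 \<le> ereal K \<and> (\<forall>l\<in>{1..n}. ereal (- K) \<le> \<psi> (X l - \<theta>))"
proof -
  have n: "n \<ge> 1" using ij by auto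
  define N where "N = real n"
  have N: "N > 0" using n by (simp add: N_def)
  \<comment> \<open>Half the distance of two distinct observations: by the triangle inequality no
    \<open>\<theta>\<close> is closer than this to both.\<close>
  define \<delta> where "\<delta> = \<bar>X i - X j\<bar> / 2"
  have \<delta>: "\<delta> > 0" using ij by (simp add: \<delta>_def)
  \<comment> \<open>Comes from a rectangle of half-width at least \<open>t * \<delta>\<close> and
    height exp (M - 1), whose area is at least \<open>t * (c * exp M)\<close>.\<close>
  define c where "c = 2 * \<delta> * exp (- 1)"
  have c: "c > 0" using \<delta> by (simp add: c_def)
  \<comment> \<open>The exponential outgrows the quadratic; the reverse inequality derived below
    then bounds M.\<close>
  have "eventually (\<lambda>M. (M - L) * (1 + N * (M - L)) < c * exp M) at_top"
    using c N by real_asymp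
  then obtain K where K: "\<And>M. M \<ge> K \<Longrightarrow> (M - L) * (1 + N * (M - L)) < c * exp M"
    by (auto simp: eventually_at_top_linorder)
  \<comment> \<open>The second entry bounds the values at the observations: M \<ge> L and a drop of
    at most N (K - L) leave at least L - N (K - L).\<close>
  define K' where "K' = max K (N * (K - L) - L)"
  show ?thesis
  proof (intro exI[of _ K'] allI ballI impI)
    fix \<theta> \<psi> assume \<psi>: "\<psi> \<in> class_SC0" and cr: "ereal L \<le> criterion X n \<theta> \<psi>"
    have "criterion X n \<theta> \<psi> > -\<infinity>" using cr by (cases "criterion X n \<theta> \<psi>") auto
    then obtain y I where y: "\<And>i. i \<in> {1..n} \<Longrightarrow> \<psi> (X i - \<theta>) = ereal (y i)"
      and I: "(\<integral>\<^sup>+x. exp_ereal (\<psi> x) \<partial>lborel) = ennreal I" "I \<ge> 0"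
      and cr_eq: "criterion X n \<theta> \<psi> = ereal ((\<Sum>i=1..n. y i) / real n - I)"
      using criterion_finiteE[OF n \<psi>] by blast
    have L: "L \<le> (\<Sum>i=1..n. y i) / N - I" using cr cr_eq by (simp add: N_def)
    have "\<psi> 0 \<noteq> \<infinity>" using \<psi> by (auto simp: class_SC0_def class_C_def)
    moreover have "\<psi> 0 \<noteq> -\<infinity>"
      using class_SC0_le_0[OF \<psi>, of "X i - \<theta>"] y[OF ij(1)] by auto
    ultimately obtain M where M: "\<psi> 0 = ereal M" by (cases "\<psi> 0") auto
    have yM: "y l \<le> M" if "l \<in> {1..n}" for l
      using class_SC0_le_0[OF \<psi>, of "X l - \<theta>"] y[OF that] M by simp
    \<comment> \<open>The level condition bounds the total drop from the peak. All drops are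
      nonnegative, so each one obeys the same bound, linear in M.\<close>
    have s_sum: "(\<Sum>l=1..n. M - y l) \<le> N * (M - L - I)"
      using L N by (simp add: sum_subtractf field_simps flip: N_def)
    have s: "M - y l \<le> N * (M - L - I)" if "l \<in> {1..n}" for l
    proof -
      have "M - y l \<le> (\<Sum>l=1..n. M - y l)"
        using that yM by (intro member_le_sum) auto
      then show ?thesis using s_sum by simp
    qed
    have s': "M - y l \<le> N * (M - L)" if "l \<in> {1..n}" for l
      using s[OF that] N I(2) by (smt (verit) mult_left_mono)
    have "0 \<le> N * (M - L - I)" using s[OF ij(1)] yM[OF ij(1)] by simp
    then have IM: "I \<le> M - L" using N by (simp add: zero_le_mult_iff)
    obtain l where l: "l \<in> {1..n}" "\<bar>X l - \<theta>\<bar> \<ge> \<delta>"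
    proof (cases "\<bar>X i - \<theta>\<bar> \<ge> \<delta>")
      case True then show ?thesis using that ij by blast
    next
      case False
      moreover have "\<bar>X i - X j\<bar> \<le> \<bar>X i - \<theta>\<bar> + \<bar>X j - \<theta>\<bar>" by linarith
      ultimately have "\<bar>X j - \<theta>\<bar> \<ge> \<delta>" by (simp add: \<delta>_def)
      then show ?thesis using that ij by blast
    qed
    define s where "s = M - y l"
    have s0: "s \<ge> 0" using yM[OF l(1)] by (simp add: s_def)
    \<comment> \<open>Along the segment from 0 to the residual, concavity limits the drop at
      fraction t to t s < 1, so \<open>\<psi>\<close> is still at least M - 1 there. Using 1 + s
      instead of s keeps t in [0, 1] for small s.\<close>
    define t where "t = 1 / (1 + s)"
    have t: "t \<in> {0..1}" using s0 by (simp add: t_def)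
    define q where "q = t * \<bar>X l - \<theta>\<bar>"
    have "ereal (1 - t) * \<psi> 0 + ereal t * \<psi> (X l - \<theta>) \<le> \<psi> ((1 - t) * 0 + t * (X l - \<theta>))"
      using \<psi> t unfolding class_SC0_def class_C_def concave_ereal_def by blast
    also have "\<dots> \<le> \<psi> q"
      using t by (intro class_SC0_antimono[OF \<psi>]) (auto simp: q_def abs_mult)
    finally have "ereal (M - t * s) \<le> \<psi> q"
      by (simp add: M y[OF l(1)] s_def algebra_simps)
    moreover have "t * s \<le> 1" using s0 by (simp add: t_def)
    then have "ereal (M - 1) \<le> ereal (M - t * s)" by simp
    ultimately have "ereal (M - 1) \<le> \<psi> q" by (rule order_trans[rotated])
    then have "ennreal (2 * q * exp (M - 1)) \<le> ennreal I"
      using t unfolding I(1)[symmetric] by (intro nn_integral_exp_ge[OF \<psi>]) (auto simp: q_def)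
    then have "2 * q * exp (M - 1) \<le> I" using I(2) by (simp add: ennreal_le_iff)
    moreover have "t * \<delta> \<le> q" using l(2) t by (auto simp: q_def intro!: mult_left_mono)
    then have "2 * (t * \<delta>) * exp (M - 1) \<le> 2 * q * exp (M - 1)" by simp
    ultimately have "2 * (t * \<delta>) * exp (M - 1) \<le> M - L"
      using IM by linarith
    then have "t * (c * exp M) \<le> M - L"
      by (simp add: c_def exp_diff exp_minus field_simps)
    then have "c * exp M \<le> (M - L) * (1 + s)" using s0 by (simp add: t_def field_simps)
    also have "\<dots> \<le> (M - L) * (1 + N * (M - L))"
      using s'[OF l(1)] IM I(2) by (intro mult_left_mono) (auto simp: s_def)
    finally have MK: "M \<le> K" using K[of M] by linarith
    show "\<psi> 0 \<le> ereal K' \<and> (\<forall>l\<in>{1..n}. ereal (- K') \<le> \<psi> (X l - \<theta>))"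
    proof (intro conjI ballI)
      have "M \<le> K'" using MK unfolding K'_def by linarith
      then show "\<psi> 0 \<le> ereal K'" using M by simp
    next
      fix l assume l: "l \<in> {1..n}"
      have "N * (M - L) \<le> N * (K - L)" using MK N by (intro mult_left_mono) auto
      then have "- K' \<le> y l" using s'[OF l] IM I(2) unfolding K'_def by linarith
      then show "ereal (- K') \<le> \<psi> (X l - \<theta>)" using y[OF l] by simp
    qed
  qed
qed

text \<open>Bolzano-Weierstrass, one index at a time: each further extraction preserves the
  convergence already obtained.\<close>

lemma finite_family_convergent_subseq:
  fixes f :: "nat \<Rightarrow> 'a \<Rightarrow> real"
  assumes "finite J" "\<And>i. i \<in> J \<Longrightarrow> bounded (range (\<lambda>k. f k i))"
  shows "\<exists>r. strict_mono (r :: nat \<Rightarrow> nat) \<and> (\<forall>i\<in>J. convergent (\<lambda>k. f (r k) i))"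
  using assms
proof (induction J rule: finite_induct)
  case empty
  then show ?case by (auto intro!: exI[of _ id] strict_mono_id)
next
  case (insert i J)
  then obtain r where r: "strict_mono r" "\<forall>i\<in>J. convergent (\<lambda>k. f (r k) i)" by auto
  have "bounded (range (\<lambda>k. f (r k) i))"
    using insert.prems[OF insertI1] by (rule bounded_subset) auto
  then obtain l r' where r': "strict_mono r'" "((\<lambda>k. f (r k) i) \<circ> r') \<longlonglongrightarrow> l"
    using bounded_imp_convergent_subsequence by blast
  have "convergent (\<lambda>k. f (r (r' k)) m)" if "m \<in> insert i J" for m
  proof (cases "m = i")
    case True
    then show ?thesis using r'(2) by (auto simp: o_def convergent_def)
  next
    case False
    then have "convergent ((\<lambda>k. f (r k) m) \<circ> r')"
      using that r(2) r'(1) by (intro convergent_subseq_convergent) auto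
    then show ?thesis by (simp add: o_def)
  qed
  then show ?case using r(1) r'(1)
    by (intro exI[of _ "r \<circ> r'"]) (auto simp: strict_mono_def)
qed

text \<open>The residuals move with k, so pointwise limits do not apply at them directly.
  Contracting the limiting residual by t < 1 gives a fixed point to compare with; the radial closure
  then takes the infimum over t, and Fatou's lemma handles the integral.\<close>

lemma class_SC0_limit:
  assumes \<psi>: "\<And>k. \<psi> k \<in> class_SC0" and K: "\<And>k. \<psi> k 0 \<le> ereal K"
    and \<theta>: "\<theta> \<longlonglongrightarrow> \<theta>'" and J: "J \<noteq> {}"
    and y: "\<And>i k. i \<in> J \<Longrightarrow> \<psi> k (x i - \<theta> k) = ereal (y k i)"
    and z: "\<And>i. i \<in> J \<Longrightarrow> (\<lambda>k. y k i) \<longlonglongrightarrow> z i"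
  shows "\<exists>\<phi>\<in>class_SC0. (\<forall>i\<in>J. ereal (z i) \<le> \<phi> (x i - \<theta>')) \<and>
    (\<integral>\<^sup>+x. exp_ereal (\<phi> x) \<partial>lborel) \<le> liminf (\<lambda>k. \<integral>\<^sup>+x. exp_ereal (\<psi> k x) \<partial>lborel)"
proof -
  have [measurable]: "\<psi> k \<in> borel_measurable borel" for k using \<psi> by (rule class_SC0_measurable)
  define \<phi> where "\<phi> x = liminf (\<lambda>k. \<psi> k x)" for x
  have \<psi>K: "\<psi> k x \<le> ereal K" for k x
    using class_SC0_le_0[OF \<psi>, of k x] K[of k] by (rule order_trans)
  have c: "concave_ereal \<phi>"
    unfolding \<phi>_def using \<psi> \<psi>K
    by (intro concave_ereal_liminf[of _ K]) (auto simp: class_SC0_def class_C_def)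
  have e: "\<phi> (- x) = \<phi> x" for x
    using \<psi> by (simp add: \<phi>_def class_SC0_def)
  have "\<phi> 0 \<le> ereal K" unfolding \<phi>_def using \<psi>K by (intro Liminf_le) auto
  then have b: "\<phi> 0 < \<infinity>" by (auto simp: less_top[symmetric] top_ereal_def)
  have ge: "ereal (z i) \<le> \<phi> (t * (x i - \<theta>'))" if i: "i \<in> J" and t: "t \<in> {0..<1}" for i t
  proof -
    let ?u = "t * (x i - \<theta>')"
    \<comment> \<open>The contraction leaves a strict gap to \<bar>x i - \<theta>'\<bar>, which
      absorbs the error of \<open>\<theta> k\<close>; if x i = \<theta>', the contracted point is
      0.\<close>
    have ev: "\<forall>\<^sub>F k in sequentially. \<bar>?u\<bar> \<le> \<bar>x i - \<theta> k\<bar>"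
    proof (cases "x i = \<theta>'")
      case False
      have "\<bar>?u\<bar> < \<bar>x i - \<theta>'\<bar>" using t False by (simp add: abs_mult)
      moreover have "(\<lambda>k. \<bar>x i - \<theta> k\<bar>) \<longlonglongrightarrow> \<bar>x i - \<theta>'\<bar>" by (intro tendsto_intros \<theta>)
      ultimately have "\<forall>\<^sub>F k in sequentially. \<bar>?u\<bar> < \<bar>x i - \<theta> k\<bar>" by (rule order_tendstoD(1)[rotated])
      then show ?thesis by (rule eventually_mono) simp
    qed simp
    have "ereal (z i) = liminf (\<lambda>k. ereal (y k i))"
      using z[OF i] by (intro lim_imp_Liminf[symmetric]) auto
    also have "\<dots> \<le> \<phi> ?u"
      unfolding \<phi>_def
    proof (rule Liminf_mono, rule eventually_mono[OF ev])
      fix k assume "\<bar>?u\<bar> \<le> \<bar>x i - \<theta> k\<bar>"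
      then show "ereal (y k i) \<le> \<psi> k ?u"
        using class_SC0_antimono[OF \<psi>] y[OF i] by metis
    qed
    finally show ?thesis .
  qed
  \<comment> \<open>With factor 0, any single index shows that the peak of the liminf is not
    -\<infinity>.\<close>
  obtain i where "i \<in> J" using J by blast
  from ge[OF this, of 0] have ne: "\<phi> 0 \<noteq> -\<infinity>" by auto
  have m: "\<phi> \<in> borel_measurable borel" unfolding \<phi>_def by measurable
  note rc = radial_closure[OF c e b ne m]
  have "(\<integral>\<^sup>+x. exp_ereal (\<phi> x) \<partial>lborel) \<le> (\<integral>\<^sup>+x. liminf (\<lambda>k. exp_ereal (\<psi> k x)) \<partial>lborel)"
    unfolding \<phi>_def by (intro nn_integral_mono exp_ereal_liminf_le)
  also have "\<dots> \<le> liminf (\<lambda>k. \<integral>\<^sup>+x. exp_ereal (\<psi> k x) \<partial>lborel)"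
    by (intro nn_integral_liminf) auto
  finally show ?thesis
    using rc ge by (intro bexI[OF _ rc(1)]) (auto intro!: INF_greatest)
qed

section \<open>Existence and location of the maximizer\<close>

text \<open>The indicator of an interval [-r, r] covering all residuals has criterion -2r. This
  keeps the supremum above -\<infinity>.\<close>

lemma criterion_finite_witness:
  assumes n: "n \<ge> 1"
  shows "\<exists>\<psi>\<in>class_SC0. \<exists>L. criterion X n \<theta> \<psi> = ereal L"
proof -
  define r where "r = (\<Sum>i=1..n. \<bar>X i - \<theta>\<bar>)"
  have r0: "r \<ge> 0" by (simp add: r_def sum_nonneg)
  have rX: "\<bar>X i - \<theta>\<bar> \<le> r" if "i \<in> {1..n}" for i
    unfolding r_def using that by (intro member_le_sum) auto
  have "(\<lambda>x. 0) \<in> class_SC0"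
    by (auto simp: class_SC0_def class_C_def concave_ereal_def upper_semicontinuous_def)
  from truncate_class_SC0[OF this r0]
  have \<psi>: "(\<lambda>x. if \<bar>x\<bar> \<le> r then 0 else -\<infinity>) \<in> class_SC0" (is "?\<psi> \<in> _") by simp
  have "(\<integral>\<^sup>+x. exp_ereal (?\<psi> x) \<partial>lborel) = (\<integral>\<^sup>+x. indicator {-r..r} x \<partial>lborel)"
    by (intro nn_integral_cong) (auto simp: indicator_def zero_ereal_def abs_le_iff)
  also have "\<dots> = ennreal (2 * r)" using r0 by simp
  finally show ?thesis
    using criterion_eq_real[OF n \<psi>, of X \<theta> "\<lambda>_. 0" "2 * r"] rX r0 \<psi> by auto
qed

theorem theorem1:
  fixes X :: "nat \<Rightarrow> real" and n :: nat
  assumes nondegenerate: "\<exists>i\<in>{1..n}. \<exists>j\<in>{1..n}. X i \<noteq> X j"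
  shows "(\<exists>\<theta> \<psi>. is_MLE X n \<theta> \<psi>) \<and>
         (\<forall>\<theta> \<psi>. is_MLE X n \<theta> \<psi> \<longrightarrow> \<theta> \<in> {Min (X ` {1..n})..Max (X ` {1..n})})"
proof -
  let ?R = "{Min (X ` {1..n})..Max (X ` {1..n})}"
  from nondegenerate obtain i\<^sub>1 i\<^sub>2 where i12: "i\<^sub>1 \<in> {1..n}" "i\<^sub>2 \<in> {1..n}" "X i\<^sub>1 \<noteq> X i\<^sub>2" by blast
  then have n: "n \<ge> 1" by auto
  have Min_mem: "Min (X ` {1..n}) \<in> ?R"
    using n Min_in[of "X ` {1..n}"] by (auto intro!: Min_le)
  define S where "S = (SUP (\<theta>', \<psi>') \<in> UNIV \<times> class_SC0. criterion X n \<theta>' \<psi>')"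
  have S_ge: "criterion X n \<theta> \<psi> \<le> S" if "\<psi> \<in> class_SC0" for \<theta> \<psi>
    unfolding S_def using that by (intro SUP_upper2[of "(\<theta>, \<psi>)"]) auto
  obtain \<psi>\<^sub>0 L\<^sub>0 where \<psi>0: "\<psi>\<^sub>0 \<in> class_SC0" "criterion X n (Min (X ` {1..n})) \<psi>\<^sub>0 = ereal L\<^sub>0"
    using criterion_finite_witness[OF n] by blast
  have SL: "ereal L\<^sub>0 \<le> S" using S_ge[OF \<psi>0(1)] \<psi>0(2) by metis
  \<comment> \<open>A level strictly below the supremum, so that a maximizing sequence eventually
    exceeds it and the a priori bounds apply to its tail.\<close>
  define L where "L = L\<^sub>0 - 1"
  have LS: "ereal L < S" using SL by (rule less_le_trans[rotated]) (simp add: L_def)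
  \<comment> \<open>Confines a maximizing sequence to locations in the compact range of the data;
    where the criterion is -\<infinity>, any location in the range will do.\<close>
  have improve: "\<exists>\<theta>'\<in>?R. \<exists>\<psi>'\<in>class_SC0. criterion X n \<theta> \<psi> \<le> criterion X n \<theta>' \<psi>'"
    if \<psi>: "\<psi> \<in> class_SC0" for \<theta> \<psi>
  proof (cases "\<theta> \<in> ?R \<or> criterion X n \<theta> \<psi> = -\<infinity>")
    case True
    then show ?thesis
    proof
      assume "\<theta> \<in> ?R"
      then show ?thesis using \<psi> by blast
    next
      assume "criterion X n \<theta> \<psi> = -\<infinity>"
      then show ?thesis by (intro bexI[OF _ Min_mem] bexI[OF _ \<psi>]) simp
    qed
  next
    case False
    then have "criterion X n \<theta> \<psi> > -\<infinity>" "\<theta> \<notin> ?R" by auto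
    from criterion_outside_range[OF n \<psi> this] show ?thesis by (blast intro: less_imp_le)
  qed

  have "\<exists>\<theta> \<psi>. is_MLE X n \<theta> \<psi>"
  proof -
    let ?A = "(\<lambda>(\<theta>', \<psi>'). criterion X n \<theta>' \<psi>') ` (UNIV \<times> class_SC0)"
    have "?A \<noteq> {}" using \<psi>0 by auto
    from Sup_countable_SUP[OF this] obtain f where f: "incseq f" "range f \<subseteq> ?A" "S = (SUP k. f k)"
      unfolding S_def by blast
    have flim: "f \<longlonglongrightarrow> S" unfolding f(3) using f(1) by (rule LIMSEQ_SUP)
    then have "\<forall>\<^sub>F k in sequentially. ereal L < f k" using LS by (rule order_tendstoD(1))
    then obtain k\<^sub>0 where k0: "\<And>k. k \<ge> k\<^sub>0 \<Longrightarrow> ereal L < f k"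
      by (auto simp: eventually_sequentially)
    have "\<exists>\<theta>'\<in>?R. \<exists>\<psi>'\<in>class_SC0. f (k + k\<^sub>0) \<le> criterion X n \<theta>' \<psi>'" for k
    proof -
      have "f (k + k\<^sub>0) \<in> ?A" using f(2) by blast
      then show ?thesis using improve by auto
    qed
    then obtain \<theta> \<psi> where \<theta>: "\<And>k. \<theta> k \<in> ?R" and \<psi>: "\<And>k. \<psi> k \<in> class_SC0"
      and fle: "\<And>k. f (k + k\<^sub>0) \<le> criterion X n (\<theta> k) (\<psi> k)"
      by metis
    have crL: "ereal L \<le> criterion X n (\<theta> k) (\<psi> k)" for k
      using k0[of "k + k\<^sub>0"] fle[of k] by simp
    then have cr_fin: "criterion X n (\<theta> k) (\<psi> k) > -\<infinity>" for k
      using crL[of k] by (cases "criterion X n (\<theta> k) (\<psi> k)") auto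
    have crlim: "(\<lambda>k. criterion X n (\<theta> k) (\<psi> k)) \<longlonglongrightarrow> S"
      by (rule tendsto_sandwich[OF _ _ LIMSEQ_ignore_initial_segment[OF flim, of k\<^sub>0] tendsto_const])
        (use fle S_ge \<psi> in auto)
    obtain K where K: "\<And>k. \<psi> k 0 \<le> ereal K"
      "\<And>k l. l \<in> {1..n} \<Longrightarrow> ereal (- K) \<le> \<psi> k (X l - \<theta> k)"
      using criterion_superlevel_bounds[OF i12, of L] \<psi> crL by blast
    have "\<exists>y I. (\<forall>i\<in>{1..n}. \<psi> k (X i - \<theta> k) = ereal (y i)) \<and>
        (\<integral>\<^sup>+x. exp_ereal (\<psi> k x) \<partial>lborel) = ennreal I \<and> I \<ge> 0 \<and>
        criterion X n (\<theta> k) (\<psi> k) = ereal ((\<Sum>i=1..n. y i) / real n - I)" for k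
      using criterion_finiteE[OF n \<psi> cr_fin] by metis
    then obtain y I where y: "\<And>k i. i \<in> {1..n} \<Longrightarrow> \<psi> k (X i - \<theta> k) = ereal (y k i)"
      and I: "\<And>k. (\<integral>\<^sup>+x. exp_ereal (\<psi> k x) \<partial>lborel) = ennreal (I k)" "\<And>k. I k \<ge> 0"
      and cr: "\<And>k. criterion X n (\<theta> k) (\<psi> k) = ereal ((\<Sum>i=1..n. y k i) / real n - I k)"
      by metis
    have yK: "\<bar>y k i\<bar> \<le> K" if "i \<in> {1..n}" for k i
      using K(2)[OF that, of k] order_trans[OF class_SC0_le_0[OF \<psi>] K(1), of k "X i - \<theta> k"]
      unfolding y[OF that] by simp
    have mean_le: "(\<Sum>i=1..n. y k i) / real n - I k \<le> K" for k
    proof -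
      have "(\<Sum>i=1..n. y k i) \<le> (\<Sum>i=1..n. K)"
        using yK by (intro sum_mono) (simp add: abs_le_iff)
      then show ?thesis using n I(2)[of k] by (simp add: field_simps add_increasing2)
    qed
    \<comment> \<open>The average is at most the peak bound and the integral is nonnegative, so the
      supremum is finite.\<close>
    have "S \<le> ereal K"
      by (rule LIMSEQ_le_const2[OF crlim]) (use cr mean_le in auto)
    then obtain s where s: "S = ereal s" using LS by (cases S) auto

    \<comment> \<open>Data indices start at 1, so slot 0 is free for \<open>\<theta>\<close>.\<close>
    define F where "F k i = (if i = 0 then \<theta> k else y k i)" for k i
    have "bounded (range (\<lambda>k. F k i))" if "i \<in> {0..n}" for i
    proof (cases "i = 0")
      case True
      have "range \<theta> \<subseteq> ?R" using \<theta> by blast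
      then have "bounded (range \<theta>)" by (rule bounded_subset[OF bounded_closed_interval])
      then show ?thesis using True by (simp add: F_def)
    next
      case False
      then show ?thesis using yK[of i] that by (auto simp: F_def bounded_iff)
    qed
    then obtain r where r: "strict_mono r" "\<And>i. i \<in> {0..n} \<Longrightarrow> convergent (\<lambda>k. F (r k) i)"
      using finite_family_convergent_subseq[of "{0..n}" F] by auto
    obtain \<theta>' where \<theta>': "(\<lambda>k. \<theta> (r k)) \<longlonglongrightarrow> \<theta>'"
      using r(2)[of 0] by (auto simp: F_def convergent_def)
    have "\<exists>z. (\<lambda>k. y (r k) i) \<longlonglongrightarrow> z" if "i \<in> {1..n}" for i
      using r(2)[of i] that by (auto simp: F_def convergent_def)
    then obtain z where z: "\<And>i. i \<in> {1..n} \<Longrightarrow> (\<lambda>k. y (r k) i) \<longlonglongrightarrow> z i" by metis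
    have "\<exists>\<phi>\<in>class_SC0. (\<forall>i\<in>{1..n}. ereal (z i) \<le> \<phi> (X i - \<theta>')) \<and>
        (\<integral>\<^sup>+x. exp_ereal (\<phi> x) \<partial>lborel) \<le> liminf (\<lambda>k. \<integral>\<^sup>+x. exp_ereal (\<psi> (r k) x) \<partial>lborel)"
      by (rule class_SC0_limit[where y = "\<lambda>k. y (r k)" and K = K, OF \<psi> K(1) \<theta>'])
        (use n y z in auto)
    then obtain \<phi> where \<phi>: "\<phi> \<in> class_SC0" "\<And>i. i \<in> {1..n} \<Longrightarrow> ereal (z i) \<le> \<phi> (X i - \<theta>')"
      and int_le: "(\<integral>\<^sup>+x. exp_ereal (\<phi> x) \<partial>lborel) \<le> liminf (\<lambda>k. ennreal (I (r k)))"
      unfolding I(1) by blast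
    let ?z = "(\<Sum>i=1..n. z i) / real n"
    \<comment> \<open>The integrals need no extraction of their own: they are averages minus
      criterion values, and both converge.\<close>
    have "(\<lambda>k. (\<Sum>i=1..n. y k i) / real n - I k) \<longlonglongrightarrow> s"
      using crlim unfolding cr s by simp
    then have "(\<lambda>k. (\<Sum>i=1..n. y (r k) i) / real n - I (r k)) \<longlonglongrightarrow> s"
      using LIMSEQ_subseq_LIMSEQ[OF _ r(1)] by (fastforce simp: o_def)
    moreover have "(\<lambda>k. (\<Sum>i=1..n. y (r k) i) / real n) \<longlonglongrightarrow> ?z"
      using n by (intro tendsto_intros z) auto
    ultimately have "(\<lambda>k. (\<Sum>i=1..n. y (r k) i) / real n -
        ((\<Sum>i=1..n. y (r k) i) / real n - I (r k))) \<longlonglongrightarrow> ?z - s"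
      by (intro tendsto_diff)
    then have Ilim: "(\<lambda>k. I (r k)) \<longlonglongrightarrow> ?z - s" by simp
    have zs: "?z - s \<ge> 0" using Ilim by (rule LIMSEQ_le_const) (use I(2) in auto)
    have "liminf (\<lambda>k. ennreal (I (r k))) = ennreal (?z - s)"
      using Ilim by (intro lim_imp_Liminf tendsto_ennrealI) auto
    with int_le have int_le': "(\<integral>\<^sup>+x. exp_ereal (\<phi> x) \<partial>lborel) \<le> ennreal (?z - s)" by simp
    then obtain I' where I': "(\<integral>\<^sup>+x. exp_ereal (\<phi> x) \<partial>lborel) = ennreal I'" "I' \<ge> 0"
      by (metis ennreal_cases ennreal_neq_top top_unique)
    have I'_le: "I' \<le> ?z - s" using int_le' zs unfolding I'(1) by (simp add: ennreal_le_iff)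
    have \<phi>_fin: "\<phi> x \<noteq> \<infinity>" for x using \<phi>(1) by (auto simp: class_SC0_def class_C_def)
    have "\<exists>v. \<phi> (X i - \<theta>') = ereal v" if "i \<in> {1..n}" for i
      using \<phi>(2)[OF that] \<phi>_fin[of "X i - \<theta>'"] by (cases "\<phi> (X i - \<theta>')") auto
    then obtain v where v: "\<And>i. i \<in> {1..n} \<Longrightarrow> \<phi> (X i - \<theta>') = ereal (v i)" by metis
    \<comment> \<open>The limit function has average at least \<open>?z\<close> and integral at most
      \<open>?z - s\<close>, hence criterion at least \<open>s\<close>.\<close>
    have "?z \<le> (\<Sum>i=1..n. v i) / real n"
      using \<phi>(2) v by (intro divide_right_mono sum_mono) auto
    moreover have "criterion X n \<theta>' \<phi> = ereal ((\<Sum>i=1..n. v i) / real n - I')"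
      using v by (intro criterion_eq_real[OF n \<phi>(1) _ I']) blast
    ultimately have "S \<le> criterion X n \<theta>' \<phi>"
      unfolding s using I'_le by simp
    then have "is_MLE X n \<theta>' \<phi>"
      unfolding is_MLE_def S_def[symmetric] using \<phi>(1) S_ge[OF \<phi>(1)] by (auto intro: antisym)
    then show ?thesis by blast
  qed
  moreover have "\<theta> \<in> ?R" if mle: "is_MLE X n \<theta> \<psi>" for \<theta> \<psi>
  proof (rule ccontr)
    assume out: "\<theta> \<notin> ?R"
    have \<psi>: "\<psi> \<in> class_SC0" and eq: "criterion X n \<theta> \<psi> = S"
      using mle by (auto simp: is_MLE_def S_def)
    have "criterion X n \<theta> \<psi> > -\<infinity>" using SL eq by (cases S) auto
    then obtain \<theta>' \<psi>' where "\<psi>' \<in> class_SC0" "S < criterion X n \<theta>' \<psi>'"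
      using criterion_outside_range[OF n \<psi> _ out] eq by auto
    then show False using S_ge[of \<psi>' \<theta>'] by simp
  qed
  ultimately show ?thesis by blast
qed

end
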